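(* Let $a_1,\ldots,a_k,b,n$ be integers with $n\geq 1$, and suppose that $\left(\sum_{i\in I} a_i,\, n\right)=1$ for every set $I$ with $\emptyset\neq I\subsetneq\{1,\ldots,k\}$. Let $N_n(b;a_1,\ldots,a_k)$ denote the number of solutions $\langle x_1,\ldots,x_k\rangle\in\mathbb{Z}_n^k$ of the linear congruence $a_1x_1+\cdots+a_kx_k\equiv b \pmod{n}$ with all $x_i$ distinct. Writing $d=\left(\sum_{i=1}^k a_i,\, n\right)$, we have $$N_n(b;a_1,\ldots,a_k)=\begin{cases}(-1)^{k}(k-1)!+(n-1)(n-2)\cdots(n-k+1), & \text{if } d\nmid b,\\ (-1)^{k-1}(k-1)!\,(d-1)+(n-1)(n-2)\cdots(n-k+1), & \text{if } d\mid b.\end{cases}$$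
   Context: $(a_1,\ldots,a_m)$ denotes the greatest common divisor of the integers $a_1,\ldots,a_m$. $\langle x_1,\ldots,x_k\rangle$ denotes an ordered $k$-tuple. A solution is a $k$-tuple in $\mathbb{Z}_n^k$ (residues modulo $n$) satisfying the congruence; "all $x_i$ distinct" means $x_u\neq x_v$ in $\mathbb{Z}_n$ for all $u\neq v$. *)

theory Defs
  imports "HOL-Number_Theory.Cong" "HOL-Library.FuncSet"
begin

(* The ring of residues modulo n is represented by the complete residue system {0..<n}, so that
   two entries are distinct as residues iff they are distinct as integers.  A k-tuple is a function
   on {1..k}, extensional (undefined outside {1..k}) so that equal tuples are equal functions and
   the cardinality below counts each tuple once. *)

definition distinct_solutions :: "int \<Rightarrow> nat \<Rightarrow> (nat \<Rightarrow> int) \<Rightarrow> int \<Rightarrow> (nat \<Rightarrow> int) set" where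
  "distinct_solutions n k a b =
     {x \<in> {1..k} \<rightarrow>\<^sub>E {0..<n}. [(\<Sum>i=1..k. a i * x i) = b] (mod n) \<and> inj_on x {1..k}}"

definition num_distinct_solutions :: "int \<Rightarrow> nat \<Rightarrow> (nat \<Rightarrow> int) \<Rightarrow> int \<Rightarrow> nat" where
  "num_distinct_solutions n k a b = card (distinct_solutions n k a b)"

end

theory Submission
  imports Defs
begin

text \<open>
  Induction on \<open>k\<close>. Since \<open>a\<^sub>k\<^sub>+\<^sub>1\<close> is a unit, any choice of distinct \<open>x\<^sub>1, \<dots>, x\<^sub>k\<close> extends
  to exactly one solution, so there are \<open>n (n - 1) \<cdots> (n - k + 1)\<close> solutions whose first \<open>k\<close>
  entries are distinct. Among these, the ones with \<open>x\<^sub>k\<^sub>+\<^sub>1 = x\<^sub>j\<close> are the distinct solutions of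
  the congruence in which \<open>a\<^sub>k\<^sub>+\<^sub>1\<close> is merged into \<open>a\<^sub>j\<close>; merging preserves both the coprimality
  hypothesis and the total coefficient sum. Hence \<open>N\<^sub>k\<^sub>+\<^sub>1 = n (n - 1) \<cdots> (n - k + 1) - k N\<^sub>k\<close>.
\<close>

section \<open>Counting functions by extension and restriction\<close>

text \<open>Erasing the value at \<open>x\<close> maps \<open>F\<close> bijectively onto
  \<open>G\<close>: uniqueness of the extension gives injectivity, its existence gives surjectivity.
  This is the tool for counting tuples whose last entry is forced by the others.\<close>

lemma card_unique_extension:
  assumes undef: "\<And>g. g \<in> G \<Longrightarrow> g x = undefined"
    and ex1: "\<And>g. g \<in> G \<Longrightarrow> \<exists>!z. g(x := z) \<in> F"
    and restr: "\<And>f. f \<in> F \<Longrightarrow> f(x := undefined) \<in> G"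
  shows "card F = card G"
proof (rule bij_betw_same_card[of "\<lambda>f. f(x := undefined)"], rule bij_betw_imageI)
  show "inj_on (\<lambda>f. f(x := undefined)) F"
  proof (rule inj_onI)
    fix f f' assume F: "f \<in> F" "f' \<in> F" and eq: "f(x := undefined) = f'(x := undefined)"
    let ?g = "f(x := undefined)"
    have f: "?g(x := f x) = f" by simp
    have f': "?g(x := f' x) = f'" unfolding eq by simp
    have "f x = f' x"
      using ex1[OF restr[OF F(1)]] f f' F by metis
    then show "f = f'" using f f' by metis
  qed
  show "(\<lambda>f. f(x := undefined)) ` F = G"
  proof
    show "(\<lambda>f. f(x := undefined)) ` F \<subseteq> G" using restr by blast
    show "G \<subseteq> (\<lambda>f. f(x := undefined)) ` F"
    proof
      fix g assume g: "g \<in> G"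
      then obtain z where z: "g(x := z) \<in> F" using ex1 by blast
      have "g = (g(x := z))(x := undefined)" using undef[OF g] by auto
      then show "g \<in> (\<lambda>f. f(x := undefined)) ` F" using z by (rule image_eqI)
    qed
  qed
qed

text \<open>An injection on \<open>insert x S\<close> is a value \<open>y\<close> at
  \<open>x\<close> together with an injection of \<open>S\<close> into \<open>T - {y}\<close>. Since
  the factors are integers, the product vanishes when \<open>S\<close> is larger than
  \<open>T\<close>, so no size condition appears.\<close>

lemma card_inj_PiE:
  assumes "finite S" "finite T"
  shows "int (card {f \<in> S \<rightarrow>\<^sub>E T. inj_on f S}) = (\<Prod>j<card S. int (card T) - int j)"
  using assms
proof (induction S arbitrary: T rule: finite_induct)
  case empty
  then show ?case by simp
next
  case (insert x S)
  let ?I = "\<lambda>y. {g \<in> S \<rightarrow>\<^sub>E (T - {y}). inj_on g S}"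
  have fin: "finite (?I y)" for y
    using insert.prems insert.hyps
    by (intro finite_subset[OF _ finite_PiE[of S "\<lambda>_. T - {y}"]]) auto
  have Sigma: "{(y, g). y \<in> T \<and> g \<in> S \<rightarrow>\<^sub>E (T - {y}) \<and> inj_on g S} = Sigma T ?I"
    by blast
  have "{f \<in> insert x S \<rightarrow>\<^sub>E T. inj_on f (insert x S)} = (\<lambda>(y, g). g(x := y)) ` Sigma T ?I"
    using extensional_funcset_extend_domain_inj_on_eq[OF insert.hyps(2), of T]
    unfolding Sigma .
  moreover have "inj_on (\<lambda>(y, g). g(x := y)) (Sigma T ?I)"
    using extensional_funcset_extend_domain_inj_onI[OF insert.hyps(2), of T]
    unfolding Sigma .
  ultimately have "card {f \<in> insert x S \<rightarrow>\<^sub>E T. inj_on f (insert x S)} = card (Sigma T ?I)"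
    by (simp add: card_image)
  also have "\<dots> = (\<Sum>y\<in>T. card (?I y))"
    using insert.prems fin by (simp add: card_SigmaI)
  finally have "int (card {f \<in> insert x S \<rightarrow>\<^sub>E T. inj_on f (insert x S)})
      = (\<Sum>y\<in>T. int (card (?I y)))" by simp
  also have "\<dots> = (\<Sum>y\<in>T. \<Prod>j<card S. int (card T) - int (Suc j))"
  proof (rule sum.cong[OF refl])
    fix y assume y: "y \<in> T"
    have "card T > 0" using y insert.prems card_gt_0_iff by blast
    then have "int (card (T - {y})) = int (card T) - 1"
      using y insert.prems by (simp add: of_nat_diff)
    then show "int (card (?I y)) = (\<Prod>j<card S. int (card T) - int (Suc j))"
      using insert.IH[of "T - {y}"] insert.prems by (simp del: card_Diff_insert add: diff_diff_eq)
  qed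
  \<comment> \<open>The summand is independent of \<open>y\<close>, so the sum contributes
    \<open>card T\<close>, which is the factor for \<open>j = 0\<close>.\<close>
  also have "\<dots> = (\<Prod>j<Suc (card S). int (card T) - int j)"
    unfolding prod.lessThan_Suc_shift by simp
  finally show ?case using insert.hyps by simp
qed

section \<open>Linear congruences in one unknown\<close>

lemma ex1_linear_cong:
  fixes c r n :: int
  assumes "n \<ge> 1" "coprime c n"
  shows "\<exists>!z. z \<in> {0..<n} \<and> [c * z = r] (mod n)"
proof -
  obtain u where u: "[c * u = r] (mod n)"
    using cong_solve_dvd_int[of c n r] assms(2) by auto
  show ?thesis
  proof (rule ex1I[of _ "u mod n"])
    show "u mod n \<in> {0..<n} \<and> [c * (u mod n) = r] (mod n)"
      using assms(1) u by (simp add: cong_def mod_mult_right_eq)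
    fix z assume z: "z \<in> {0..<n} \<and> [c * z = r] (mod n)"
    then have "[c * z = c * u] (mod n)" using u by (meson cong_sym cong_trans)
    then have "[z = u] (mod n)" using assms(2) cong_mult_lcancel by blast
    then show "z = u mod n" using z by (simp add: cong_def)
  qed
qed

text \<open>A solvable congruence can be divided by \<open>gcd c n\<close>. The reduced coefficient
  is a unit, so the solutions form a single class modulo \<open>n'\<close>, and this class meets
  \<open>{0..<n}\<close> in \<open>gcd c n\<close> points.\<close>

lemma card_linear_cong:
  fixes c r n :: int
  assumes "n \<ge> 1"
  shows "int (card {z \<in> {0..<n}. [c * z = r] (mod n)}) = (if gcd c n dvd r then gcd c n else 0)"
proof (cases "gcd c n dvd r")
  case False
  have "\<not> [c * z = r] (mod n)" for z
  proof
    assume "[c * z = r] (mod n)"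
    then have "[c * z = r] (mod gcd c n)"
      by (rule cong_dvd_modulus) simp
    then have "gcd c n dvd r"
      by (metis cong_dvd_iff dvd_mult2 gcd_dvd1)
    with False show False ..
  qed
  with False show ?thesis by simp
next
  case True
  define g where "g = gcd c n"
  have g: "g > 0" using assms by (simp add: g_def)
  obtain c' n' where cn: "c = g * c'" "n = g * n'" "coprime c' n'"
    using gcd_coprime_exists[of c n] g unfolding g_def by (metis less_irrefl mult.commute)
  obtain r' where r: "r = g * r'" using True unfolding g_def ..
  have n': "n' \<ge> 1" using assms cn(2) g by (smt (verit) mult_nonneg_nonpos)
  obtain z0 where z0: "z0 \<in> {0..<n'}" "[c' * z0 = r'] (mod n')"
    and uniq: "\<And>z. z \<in> {0..<n'} \<Longrightarrow> [c' * z = r'] (mod n') \<Longrightarrow> z = z0"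
    using ex1_linear_cong[OF n' cn(3), of r'] by blast
  have iff: "[c * z = r] (mod n) \<longleftrightarrow> z mod n' = z0" for z
  proof -
    have "[c * z = r] (mod n) \<longleftrightarrow> [c' * z = r'] (mod n')"
      unfolding cn r cong_iff_dvd_diff using g
      by (simp add: mult.assoc flip: right_diff_distrib)
    also have "\<dots> \<longleftrightarrow> z mod n' = z0"
    proof
      assume "[c' * z = r'] (mod n')"
      then have "[c' * (z mod n') = r'] (mod n')" by (simp add: cong_def mod_mult_right_eq)
      then show "z mod n' = z0" using n' by (intro uniq) auto
    next
      assume "z mod n' = z0"
      then show "[c' * z = r'] (mod n')"
        using z0(2) by (metis cong_def mod_mult_right_eq)
    qed
    finally show ?thesis .
  qed
  \<comment> \<open>As \<open>n = g * n'\<close>, the members of the class of \<open>z0\<close> in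
    \<open>{0..<n}\<close> are \<open>z0 + n' * t\<close> for \<open>0 \<le> t < g\<close>, and
    \<open>t\<close> is recovered as the quotient by \<open>n'\<close>.\<close>
  have "bij_betw (\<lambda>t. z0 + n' * t) {0..<g} {z \<in> {0..<n}. [c * z = r] (mod n)}"
  proof (rule bij_betw_byWitness[where f' = "\<lambda>z. z div n'"])
    show "\<forall>t\<in>{0..<g}. (z0 + n' * t) div n' = t" using z0(1) by auto
    show "\<forall>z\<in>{z \<in> {0..<n}. [c * z = r] (mod n)}. z0 + n' * (z div n') = z"
      unfolding iff by (auto simp: mult.commute)
    show "(\<lambda>t. z0 + n' * t) ` {0..<g} \<subseteq> {z \<in> {0..<n}. [c * z = r] (mod n)}"
    proof safe
      fix t assume t: "t \<in> {0..<g}"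
      then have "n' * (t + 1) \<le> n' * g" using n' by (intro mult_left_mono) auto
      then have "z0 + n' * t < n" using z0(1) cn(2) by (simp add: algebra_simps)
      then show "z0 + n' * t \<in> {0..<n}" using t z0(1) n' by auto
      show "[c * (z0 + n' * t) = r] (mod n)" unfolding iff using z0(1) by simp
    qed
    show "(\<lambda>z. z div n') ` {z \<in> {0..<n}. [c * z = r] (mod n)} \<subseteq> {0..<g}"
    proof safe
      fix z assume "z \<in> {0..<n}"
      then show "z div n' \<in> {0..<g}"
        using n' cn(2) by (auto simp: pos_imp_zdiv_nonneg_iff div_less_iff_less_mult algebra_simps)
          (smt (verit) mult.commute pos_mod_sign mult_left_mono
            minus_mult_div_eq_mod mult_less_cancel_left_pos)
    qed
  qed
  from bij_betw_same_card[OF this]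
  have "card {z \<in> {0..<n}. [c * z = r] (mod n)} = nat g" by simp
  then show ?thesis using True g by (simp add: g_def)
qed

section \<open>One variable, and the recurrence in the number of variables\<close>

text \<open>This starts the induction. The set \<open>{1}\<close> has no nonempty proper subset, so
  nothing is assumed about \<open>a 1\<close> and the gcd may be any divisor of
  \<open>n\<close>.\<close>

lemma num_distinct_solutions_1:
  assumes "n \<ge> 1"
  shows "int (num_distinct_solutions n 1 a b) = (if gcd (a 1) n dvd b then gcd (a 1) n else 0)"
proof -
  let ?Z = "{z \<in> {0..<n}. [a 1 * z = b] (mod n)}"
  have mem: "(\<lambda>i\<in>{1}. z) \<in> distinct_solutions n 1 a b \<longleftrightarrow> z \<in> ?Z" for z
    by (simp add: distinct_solutions_def restrict_PiE_iff)
  have eta: "(\<lambda>i\<in>{1}. x 1) = x" if "x \<in> distinct_solutions n 1 a b" for x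
  proof -
    have "x \<in> extensional {1}" using that by (simp add: distinct_solutions_def PiE_def)
    then show ?thesis by (intro extensionalityI[of _ "{1}"]) simp_all
  qed
  have "bij_betw (\<lambda>z. \<lambda>i\<in>{1}. z) ?Z (distinct_solutions n 1 a b)"
  proof (rule bij_betw_byWitness[where f' = "\<lambda>x. x 1"])
    show "\<forall>z\<in>?Z. (\<lambda>i\<in>{1}. z) 1 = z" by simp
    show "\<forall>x\<in>distinct_solutions n 1 a b. (\<lambda>i\<in>{1}. x 1) = x" using eta by blast
    show "(\<lambda>z. \<lambda>i\<in>{1}. z) ` ?Z \<subseteq> distinct_solutions n 1 a b" using mem by blast
    show "(\<lambda>x. x 1) ` distinct_solutions n 1 a b \<subseteq> ?Z"
    proof (rule image_subsetI)
      fix x assume "x \<in> distinct_solutions n 1 a b"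
      then show "x 1 \<in> ?Z" by (subst mem[symmetric]) (simp only: eta)
    qed
  qed
  then have "num_distinct_solutions n 1 a b = card ?Z"
    unfolding num_distinct_solutions_def by (rule bij_betw_same_card[symmetric])
  then show ?thesis using card_linear_cong[OF assms] by simp
qed

lemma num_distinct_solutions_Suc:
  assumes n: "n \<ge> 1" and cop: "coprime (a (Suc k)) n"
  shows "int (num_distinct_solutions n (Suc k) a b) = (\<Prod>j<k. n - int j)
    - (\<Sum>j=1..k. int (num_distinct_solutions n k (a(j := a j + a (Suc k))) b))"
proof -
  let ?s = "Suc k"
  let ?S = "{1..k}" and ?T = "{0..<n}"
  have ins: "{1..?s} = insert ?s ?S" by auto
  \<comment> \<open>In \<open>A\<close> the last entry may repeat an earlier one; \<open>B j\<close>
    collects the tuples where it repeats entry \<open>j\<close>. Injectivity on \<open>?S\<close>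
    allows at most one such \<open>j\<close>.\<close>
  define A where "A = {x \<in> {1..?s} \<rightarrow>\<^sub>E ?T. [(\<Sum>i=1..?s. a i * x i) = b] (mod n) \<and> inj_on x ?S}"
  define B where "B j = {x \<in> A. x ?s = x j}" for j
  let ?D = "distinct_solutions n ?s a b"
  have finA: "finite A"
    unfolding A_def by (rule finite_subset[OF _ finite_PiE[of "{1..?s}" "\<lambda>_. ?T"]]) auto
  have split: "A = ?D \<union> (\<Union>j\<in>?S. B j)"
    unfolding distinct_solutions_def A_def B_def ins by auto
  have disj: "?D \<inter> (\<Union>j\<in>?S. B j) = {}"
    unfolding distinct_solutions_def B_def by (force simp: inj_on_def)
  have disjB: "B i \<inter> B j = {}" if "i \<in> ?S" "j \<in> ?S" "i \<noteq> j" for i j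
  proof (rule ccontr)
    assume "B i \<inter> B j \<noteq> {}"
    then obtain x where x: "x \<in> B i" "x \<in> B j" by blast
    have "inj_on x ?S" using x(1) unfolding B_def A_def by blast
    moreover have "x i = x j" using x unfolding B_def by simp
    ultimately show False using that inj_on_eq_iff[of x ?S i j] by blast
  qed
  have finD: "finite ?D" using finA split by (metis finite_Un)
  have finB: "finite (B j)" for j using finA by (simp add: B_def)
  have upd_PiE: "g(?s := z) \<in> {1..?s} \<rightarrow>\<^sub>E ?T \<longleftrightarrow> z \<in> ?T" if "g \<in> ?S \<rightarrow>\<^sub>E ?T" for g z
  proof
    assume "g(?s := z) \<in> {1..?s} \<rightarrow>\<^sub>E ?T"
    from PiE_mem[OF this, of ?s] show "z \<in> ?T" by simp
  qed (unfold ins, rule PiE_fun_upd[OF _ that])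
  have upd_inj: "inj_on (f(?s := z)) ?S \<longleftrightarrow> inj_on f ?S" for f :: "nat \<Rightarrow> int" and z
    by (intro inj_on_cong) simp
  have upd_sum: "(\<Sum>i=1..k. c i * (f(?s := z)) i) = (\<Sum>i=1..k. c i * f i)"
    for c f :: "nat \<Rightarrow> int" and z
    by (intro sum.cong) simp_all
  have undef_PiE: "f(?s := undefined) \<in> ?S \<rightarrow>\<^sub>E ?T" if "f \<in> {1..?s} \<rightarrow>\<^sub>E ?T" for f
    using that unfolding ins by (intro fun_upd_in_PiE) simp_all
  have cardA: "int (card A) = (\<Prod>j<k. n - int j)"
  proof -
    let ?G = "{g \<in> ?S \<rightarrow>\<^sub>E ?T. inj_on g ?S}"
    have "card A = card ?G"
    proof (rule card_unique_extension[of _ ?s])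
      fix g assume "g \<in> ?G"
      then have g: "g \<in> ?S \<rightarrow>\<^sub>E ?T" "inj_on g ?S" by blast+
      show "g ?s = undefined" using g(1) by (rule PiE_arb) simp
      let ?r = "\<Sum>i=1..k. a i * g i"
      \<comment> \<open>For fixed earlier entries, the congruence is linear in \<open>z\<close> with
        the unit coefficient \<open>a ?s\<close>.\<close>
      have "g(?s := z) \<in> A \<longleftrightarrow> z \<in> ?T \<and> [a ?s * z = b - ?r] (mod n)" for z
      proof -
        have sum: "(\<Sum>i=1..?s. a i * (g(?s := z)) i) = ?r + a ?s * z"
          using upd_sum by simp
        have cong: "[?r + a ?s * z = b] (mod n) \<longleftrightarrow> [a ?s * z = b - ?r] (mod n)"
          by (simp add: cong_iff_dvd_diff algebra_simps)
        show ?thesis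
          unfolding A_def mem_Collect_eq upd_PiE[OF g(1)] upd_inj sum cong using g(2) by blast
      qed
      then show "\<exists>!z. g(?s := z) \<in> A" using ex1_linear_cong[OF n cop, of "b - ?r"] by simp
    next
      fix f assume "f \<in> A"
      then show "f(?s := undefined) \<in> ?G"
        unfolding A_def mem_Collect_eq upd_inj using undef_PiE by blast
    qed
    then show ?thesis using card_inj_PiE[of ?S ?T] n by simp
  qed
  have cardB: "card (B j) = num_distinct_solutions n k (a(j := a j + a ?s)) b" if j: "j \<in> ?S" for j
    unfolding num_distinct_solutions_def
  proof (rule card_unique_extension[of _ ?s])
    let ?a = "a(j := a j + a ?s)"
    have merge: "(\<Sum>i=1..k. ?a i * g i) = (\<Sum>i=1..k. a i * g i) + a ?s * g j" for g :: "nat \<Rightarrow> int"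
      using j by (simp add: sum.remove[of _ j] algebra_simps)
    have j_s: "j \<noteq> ?s" using j by simp
    {
      fix g assume "g \<in> distinct_solutions n k ?a b"
      then have g: "g \<in> ?S \<rightarrow>\<^sub>E ?T" "inj_on g ?S" "[(\<Sum>i=1..k. ?a i * g i) = b] (mod n)"
        unfolding distinct_solutions_def by blast+
      show "g ?s = undefined" using g(1) by (rule PiE_arb) simp
      \<comment> \<open>In \<open>B j\<close> the last entry must be \<open>g j\<close>, so its term
        \<open>a ?s * g j\<close> joins the term of index \<open>j\<close>.\<close>
      have "(\<Sum>i=1..?s. a i * (g(?s := g j)) i) = (\<Sum>i=1..k. ?a i * g i)"
        unfolding merge using upd_sum by simp
      then have "g(?s := g j) \<in> A"
        unfolding A_def mem_Collect_eq upd_PiE[OF g(1)] upd_inj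
        using g(2,3) PiE_mem[OF g(1) j] by simp
      then have "g(?s := g j) \<in> B j" using j_s by (simp add: B_def)
      moreover have "z = g j" if "g(?s := z) \<in> B j" for z
        using that j_s by (simp add: B_def)
      ultimately show "\<exists>!z. g(?s := z) \<in> B j" by blast
    next
      fix f assume "f \<in> B j"
      then have f: "f \<in> {1..?s} \<rightarrow>\<^sub>E ?T" "inj_on f ?S" "[(\<Sum>i=1..?s. a i * f i) = b] (mod n)"
        and f_s: "f ?s = f j"
        unfolding B_def A_def by blast+
      have "(\<Sum>i=1..k. ?a i * (f(?s := undefined)) i) = (\<Sum>i=1..?s. a i * f i)"
        unfolding upd_sum merge using f_s by simp
      then show "f(?s := undefined) \<in> distinct_solutions n k ?a b"
        unfolding distinct_solutions_def mem_Collect_eq upd_inj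
        using f(2,3) undef_PiE[OF f(1)] by simp
    }
  qed
  have "card A = card ?D + card (\<Union>j\<in>?S. B j)"
    unfolding split using disj finD finB by (intro card_Un_disjoint) auto
  also have "card (\<Union>j\<in>?S. B j) = (\<Sum>j\<in>?S. card (B j))"
    using finB disjB by (intro card_UN_disjoint) auto
  also have "\<dots> = (\<Sum>j=1..k. num_distinct_solutions n k (a(j := a j + a ?s)) b)"
    using cardB by simp
  finally show ?thesis using cardA by (simp add: num_distinct_solutions_def)
qed

section \<open>Solving the recurrence\<close>

text \<open>Both cases of the formula share one shape, with a factor depending only on
  \<open>d\<close> and \<open>b\<close>. Merging coefficients keeps \<open>d\<close>, so all terms
  of the recurrence have the same value; the induction fixes \<open>d\<close> and \<open>b\<close>
  and varies \<open>a\<close>.\<close>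

lemma int_num_distinct_solutions:
  fixes a :: "nat \<Rightarrow> int"
  assumes n: "n \<ge> 1"
    and cop: "\<And>I. I \<noteq> {} \<Longrightarrow> I \<subset> {1..Suc k} \<Longrightarrow> gcd (\<Sum>i\<in>I. a i) n = 1"
    and d: "d = gcd (\<Sum>i=1..Suc k. a i) n"
  shows "int (num_distinct_solutions n (Suc k) a b) =
    (-1) ^ k * fact k * (if d dvd b then d - 1 else -1) + (\<Prod>j=1..k. n - int j)"
  using cop d
proof (induction k arbitrary: a)
  case 0
  \<comment> \<open>The empty product adds 1, turning \<open>d - 1\<close> and \<open>-1\<close>
    into the counts \<open>d\<close> and 0.\<close>
  then show ?case using num_distinct_solutions_1[OF n, of a b] by simp
next
  case (Suc k)
  let ?s = "Suc (Suc k)" and ?e = "if d dvd b then d - 1 else -1"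
  let ?a = "\<lambda>j. a(j := a j + a ?s)"
  have IH: "int (num_distinct_solutions n (Suc k) (?a j) b) =
      (-1) ^ k * fact k * ?e + (\<Prod>j=1..k. n - int j)" if j: "j \<in> {1..Suc k}" for j
  proof (rule Suc.IH)
    fix I assume I: "I \<noteq> {}" "I \<subset> {1..Suc k}"
    have fin: "finite I" using I(2) finite_subset by blast
    have s: "?s \<notin> I" using I(2) by auto
    \<comment> \<open>If \<open>j\<close> lies in \<open>I\<close>, the merged sum is the original
      one over \<open>insert ?s I\<close>, still a proper subset because \<open>I\<close> misses
      some index up to \<open>Suc k\<close>. Otherwise the sum is unchanged.\<close>
    show "gcd (\<Sum>i\<in>I. ?a j i) n = 1"
    proof (cases "j \<in> I")
      case True
      have "(\<Sum>i\<in>I. ?a j i) = (\<Sum>i\<in>insert ?s I. a i)"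
        using fin True s by (simp add: sum.remove[of I j])
      moreover have "insert ?s I \<subset> {1..?s}"
        using I(2) s by (simp add: atLeastAtMostSuc_conv psubset_eq insert_ident subset_insertI2)
      ultimately show ?thesis using Suc.prems(1)[of "insert ?s I"] by simp
    next
      case False
      then have "(\<Sum>i\<in>I. ?a j i) = (\<Sum>i\<in>I. a i)" by (intro sum.cong) auto
      moreover have "I \<subset> {1..?s}" using I(2) by auto
      ultimately show ?thesis using Suc.prems(1) I(1) by simp
    qed
  next
    have "(\<Sum>i=1..Suc k. ?a j i) = (\<Sum>i=1..?s. a i)"
      using j by (subst sum.cl_ivl_Suc) (simp add: sum.remove[of _ j] del: sum.cl_ivl_Suc)
    then show "d = gcd (\<Sum>i=1..Suc k. ?a j i) n" using Suc.prems(2) by simp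
  qed
  \<comment> \<open>The singleton \<open>{?s}\<close> is a proper subset because \<open>?s\<close>
    is at least 2.\<close>
  have "coprime (a ?s) n"
    using Suc.prems(1)[of "{?s}"] by (force simp: coprime_iff_gcd_eq_1)
  with num_distinct_solutions_Suc[OF n, of a "Suc k" b]
  have "int (num_distinct_solutions n ?s a b) = (\<Prod>j<Suc k. n - int j)
      - int (Suc k) * ((-1) ^ k * fact k * ?e + (\<Prod>j=1..k. n - int j))"
    using IH by simp
  also have "(\<Prod>j<Suc k. n - int j) = n * (\<Prod>j=1..k. n - int j)"
    unfolding prod.lessThan_Suc_shift
    by (simp add: prod.atLeast1_atMost_eq)
  \<comment> \<open>Collecting the products leaves the new factor \<open>n - int (Suc k)\<close>,
    while \<open>- int (Suc k)\<close> flips the sign and extends the factorial.\<close>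
  also have "n * (\<Prod>j=1..k. n - int j) - int (Suc k) * ((-1) ^ k * fact k * ?e + (\<Prod>j=1..k. n - int j))
      = (-1) ^ Suc k * fact (Suc k) * ?e + (\<Prod>j=1..Suc k. n - int j)"
    by (simp add: algebra_simps)
  finally show ?case .
qed

theorem theorem2p3:
  fixes a :: "nat \<Rightarrow> int" and b n d :: int and k :: nat
  assumes "n \<ge> 1" and "k \<ge> 1"
    and "\<And>I. I \<noteq> {} \<Longrightarrow> I \<subset> {1..k} \<Longrightarrow> gcd (\<Sum>i\<in>I. a i) n = 1"
    and "d = gcd (\<Sum>i=1..k. a i) n"
  shows "int (num_distinct_solutions n k a b) =
    (if \<not> d dvd b
     then (-1) ^ k * fact (k - 1) + (\<Prod>j=1..k-1. n - int j)
     else (-1) ^ (k - 1) * fact (k - 1) * (d - 1) + (\<Prod>j=1..k-1. n - int j))"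
proof -
  obtain m where k: "k = Suc m" using assms(2) by (cases k) auto
  \<comment> \<open>For \<open>d\<close> not dividing \<open>b\<close>, the factor \<open>-1\<close>
    turns \<open>(-1) ^ (k - 1)\<close> into \<open>(-1) ^ k\<close>.\<close>
  show ?thesis
    using int_num_distinct_solutions[of n m a d b] assms(1,3,4) unfolding k by simp
qed

end
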